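(* Let $T$ be a tree on $n\ge 2$ vertices. Then $T$ admits an $\varepsilon$-factorization for some $\varepsilon\le \frac1n$. More precisely, if one bipartition class of $T$ has even size, then $T$ admits an $\varepsilon$-factorization with $\varepsilon\le \frac{n-1}{n^2}$; and if both bipartition classes of $T$ have odd size, then $T$ admits an $\varepsilon$-factorization with $\varepsilon\le \frac{n}{n^2}=\frac1n$.
   Context: All graphs are finite, simple and undirected; $N_H(u)$ denotes the set of neighbours of $u$ in $H$. Let $0\le\varepsilon\le 1$ and let $G$ be a simple graph on $n$ vertices. $G$ admits an $\varepsilon$-factorization if there exist simple graphs $H$ and $K$ on the vertex set $V(G)$ and a set of ordered pairs $\mathcal E\subseteq V(G)\times V(G)$ with $|\mathcal E|\le \varepsilon n^2$ such that, for every $(u,v)\in (V(G)\times V(G))\setminus\mathcal E$ (including pairs with $u=v$), $|N_H(u)\cap N_K(v)|=1$ if $uv\in E(G)$ and $|N_H(u)\cap N_K(v)|=0$ otherwise. Equivalently, for a common ordering of the vertices, $A(H)A(K)$ and $A(G)$ disagree in at most $\varepsilon n^2$ entries. *)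

theory Defs
  imports Complex_Main "Graph_Theory.Graph_Theory"
begin

(* A finite simple undirected graph is a G with pair_graph G: parcs G is a finite,
   irreflexive and symmetric relation on the finite set pverts G, and the undirected edge uv
   is the pair of arcs (u,v), (v,u). *)

definition neighbours :: "'a pair_pre_digraph \<Rightarrow> 'a \<Rightarrow> 'a set" where
  "neighbours G u = {w. (u, w) \<in> parcs G}"

(* The library counts the closed walk u, v, u along a single edge as a cycle, so its
   predicates forest and tree reject every symmetric graph with an edge. Requiring length
   at least 3 leaves exactly the cycles of the undirected graph. *)

definition simple_tree :: "'a pair_pre_digraph \<Rightarrow> bool" where
  "simple_tree G \<longleftrightarrow> pair_graph G \<and> Digraph_Component.connected (with_proj G) \<and>
     \<not> (\<exists>p. pre_digraph.cycle (with_proj G) p \<and> length p \<ge> 3)"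

definition bipartition :: "'a pair_pre_digraph \<Rightarrow> 'a set \<Rightarrow> 'a set \<Rightarrow> bool" where
  "bipartition G X Y \<longleftrightarrow> X \<union> Y = pverts G \<and> X \<inter> Y = {} \<and>
     (\<forall>(u, v) \<in> parcs G. (u \<in> X \<and> v \<in> Y) \<or> (u \<in> Y \<and> v \<in> X))"

definition admits_factorization :: "real \<Rightarrow> 'a pair_pre_digraph \<Rightarrow> bool" where
  "admits_factorization \<epsilon> G \<longleftrightarrow> 0 \<le> \<epsilon> \<and> \<epsilon> \<le> 1 \<and>
     (\<exists>H K \<E>. pair_graph H \<and> pverts H = pverts G \<and>
        pair_graph K \<and> pverts K = pverts G \<and>
        \<E> \<subseteq> pverts G \<times> pverts G \<and>
        real (card \<E>) \<le> \<epsilon> * (real (card (pverts G)))\<^sup>2 \<and>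
        (\<forall>(u, v) \<in> (pverts G \<times> pverts G) - \<E>.
           card (neighbours H u \<inter> neighbours K v) = (if (u, v) \<in> parcs G then 1 else 0)))"

end

theory Submission
  imports Defs
begin

text \<open>
  Let \<open>S\<close> be an independent set of even size in a graph \<open>G\<close>, let \<open>H\<close> be a perfect matching
  on \<open>S\<close>, with all other vertices isolated, and write \<open>\<sigma>\<close> for the involution of \<open>S\<close> that swaps
  matched vertices. Row \<open>u\<close> of \<open>A(H) A(K)\<close> is then row \<open>\<sigma> u\<close> of \<open>A(K)\<close> when \<open>u \<in> S\<close>, and zero
  otherwise. Joining \<open>\<sigma> u\<close> in \<open>K\<close> to the neighbours of \<open>u\<close> in \<open>G\<close>, for every \<open>u \<in> S\<close>,
  makes all rows in \<open>S\<close> correct: because \<open>S\<close> is independent, no edge of \<open>K\<close> lies inside \<open>S\<close>, so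
  symmetrizing \<open>K\<close> does not disturb these rows. The only wrong entries are the arcs of \<open>G\<close> that
  start outside \<open>S\<close> (\<open>factorization_from_independent_set\<close>).

  A tree has \<open>n - 1\<close> edges, hence \<open>n - 1\<close> arcs leave each bipartition class. If a class has even
  size, taking it for \<open>S\<close> leaves the \<open>n - 1\<close> arcs out of the other class as errors. If both
  classes are odd, taking for \<open>S\<close> the class of some leaf, without this leaf, costs just
  one further arc.
\<close>

section \<open>Trees as symmetric relations\<close>

text \<open>
  A cycle is represented by the list of its vertices, the first one not repeated at the end, instead
  of a closed walk of arcs: the cycles that are built below then arise directly as segments of paths.
\<close>

definition rel_cycle :: "'a rel \<Rightarrow> 'a list \<Rightarrow> bool" where
  "rel_cycle E xs \<longleftrightarrow> 3 \<le> length xs \<and> distinct xs \<and>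
     successively (\<lambda>x y. (x, y) \<in> E) xs \<and> (last xs, hd xs) \<in> E"

definition rel_tree :: "'a set \<Rightarrow> 'a rel \<Rightarrow> bool" where
  "rel_tree V E \<longleftrightarrow> finite V \<and> V \<noteq> {} \<and> E \<subseteq> V \<times> V \<and> sym E \<and> irrefl E \<and>
     (\<forall>u\<in>V. \<forall>v\<in>V. (u, v) \<in> E\<^sup>*) \<and> \<not> (\<exists>xs. rel_cycle E xs)"

text \<open>
  The first vertex of a longest path is a leaf: a neighbour of it off the path would extend the
  path, and a neighbour on the path other than the second vertex would close a cycle.
\<close>

lemma rel_tree_has_leaf:
  assumes tree: "rel_tree V E" and "2 \<le> card V"
  shows "\<exists>l\<in>V. \<exists>p. {w. (l, w) \<in> E} = {p}"
proof -
  let ?path = "\<lambda>xs. distinct xs \<and> set xs \<subseteq> V \<and> successively (\<lambda>x y. (x, y) \<in> E) xs"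
  have fin: "finite V" and EV: "E \<subseteq> V \<times> V" and sym: "sym E" and irr: "irrefl E"
    and conn: "\<And>u v. u \<in> V \<Longrightarrow> v \<in> V \<Longrightarrow> (u, v) \<in> E\<^sup>*"
    and acyc: "\<And>xs. \<not> rel_cycle E xs"
    using tree by (simp_all add: rel_tree_def)
  have "\<not> card V \<le> Suc 0"
    using \<open>2 \<le> card V\<close> by simp
  then obtain a b where ab: "a \<in> V" "b \<in> V" "a \<noteq> b"
    unfolding card_le_Suc0_iff_eq[OF fin] by blast
  then obtain c where "(a, c) \<in> E"
    using conn[OF ab(1,2)] by (blast elim: converse_rtranclE)
  then have edge: "?path [a, c]"
    using EV irr by (auto simp: irrefl_def)
  have "length xs < Suc (card V)" if "?path xs" for xs
    using that fin card_mono[of V "set xs"] by (simp add: distinct_card less_Suc_eq_le)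
  then have "\<exists>xs. ?path xs \<and> (\<forall>ys. ?path ys \<longrightarrow> length ys \<le> length xs)"
    by (intro ex_has_greatest_nat[of ?path "[a, c]" length "Suc (card V)"] edge) simp
  then obtain xs where "?path xs \<and> (\<forall>ys. ?path ys \<longrightarrow> length ys \<le> length xs)"
    by (rule exE)
  then have path: "?path xs" and longest: "\<And>ys. ?path ys \<Longrightarrow> length ys \<le> length xs"
    by simp_all
  have "2 \<le> length xs"
    using longest[OF edge] by simp
  then obtain l p rest where xs: "xs = l # p # rest"
    by (auto simp: numeral_2_eq_2 Suc_le_length_iff)
  have lp: "(l, p) \<in> E"
    using path xs by simp
  have "w = p" if lw: "(l, w) \<in> E" for w
  proof (rule ccontr)
    assume "w \<noteq> p"
    have wl: "(w, l) \<in> E"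
      using lw sym by (auto dest: symD)
    have "w \<in> set xs"
    proof (rule ccontr)
      assume "w \<notin> set xs"
      then have "?path (w # xs)"
        using path wl subsetD[OF EV wl] by (simp add: xs)
      then show False
        using longest[of "w # xs"] by simp
    qed
    then have "w \<in> set rest"
      using xs \<open>w \<noteq> p\<close> lw irr by (auto simp: irrefl_def)
    then obtain as bs where rest: "rest = as @ w # bs"
      using split_list by fastforce
    have "xs = (l # p # as @ [w]) @ bs"
      using xs rest by simp
    then have "distinct (l # p # as @ [w])" "successively (\<lambda>x y. (x, y) \<in> E) (l # p # as @ [w])"
      using path by (simp_all only: distinct_append successively_append_iff)
    then show False
      using acyc[of "l # p # as @ [w]"] wl by (simp add: rel_cycle_def)
  qed
  then have "{w. (l, w) \<in> E} = {p}"
    using lp by blast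
  then show ?thesis
    using path xs by auto
qed

text \<open>
  A path between two vertices other than the leaf \<open>l\<close> can be cut short whenever it visits \<open>l\<close>,
  because it enters and leaves \<open>l\<close> through \<open>p\<close>.
\<close>

lemma rel_tree_remove_leaf:
  assumes tree: "rel_tree V E" and "l \<in> V" and leaf: "{w. (l, w) \<in> E} = {p}"
  defines "V' \<equiv> V - {l}" and "E' \<equiv> E \<inter> (V - {l}) \<times> (V - {l})"
  shows "rel_tree V' E'" and "p \<in> V'" and "E = insert (l, p) (insert (p, l) E')"
proof -
  have fin: "finite V" and EV: "E \<subseteq> V \<times> V" and sym: "sym E" and irr: "irrefl E"
    and conn: "\<And>u v. u \<in> V \<Longrightarrow> v \<in> V \<Longrightarrow> (u, v) \<in> E\<^sup>*"
    and acyc: "\<And>xs. \<not> rel_cycle E xs"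
    using tree by (simp_all add: rel_tree_def)
  have lE: "(l, w) \<in> E \<longleftrightarrow> w = p" for w
    using leaf by blast
  then have El: "(w, l) \<in> E \<longleftrightarrow> w = p" for w
    using sym unfolding sym_def by blast
  show pV: "p \<in> V'"
    using lE[of p] EV irr by (auto simp: V'_def irrefl_def)
  show "E = insert (l, p) (insert (p, l) E')"
    using lE El EV by (auto simp: E'_def)
  have "(v \<noteq> l \<longrightarrow> (u, v) \<in> E'\<^sup>*) \<and> (v = l \<longrightarrow> (u, p) \<in> E'\<^sup>*)" if "(u, v) \<in> E\<^sup>*" "u \<noteq> l" for u v
    using that
  proof (induction rule: rtrancl_induct)
    case base
    then show ?case by simp
  next
    case (step y z)
    show ?case
    proof (cases "y = l \<or> z = l")
      case True
      then show ?thesis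
        using step lE El irr by (auto simp: irrefl_def)
    next
      case False
      then have "(y, z) \<in> E'"
        using step EV by (auto simp: E'_def)
      then show ?thesis
        using step False by auto
    qed
  qed
  then have conn': "(u, v) \<in> E'\<^sup>*" if "u \<in> V'" "v \<in> V'" for u v
    using that conn by (auto simp: V'_def)
  have "rel_cycle E xs" if "rel_cycle E' xs" for xs
    using that successively_mono[of "\<lambda>x y. (x, y) \<in> E'" xs "\<lambda>x y. (x, y) \<in> E"]
    by (auto simp: rel_cycle_def E'_def)
  then have acyc': "\<not> rel_cycle E' xs" for xs
    using acyc by blast
  have "sym E'" "irrefl E'"
    using sym irr by (auto simp: E'_def sym_def irrefl_def)
  then show "rel_tree V' E'"
    unfolding rel_tree_def using fin pV conn' acyc' by (auto simp: E'_def V'_def)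
qed

lemma rel_tree_induct [consumes 1, case_names single leaf]:
  assumes "rel_tree V E"
    and single: "\<And>v. P {v} {}"
    and leaf: "\<And>V E l p. rel_tree V E \<Longrightarrow> P V E \<Longrightarrow> l \<notin> V \<Longrightarrow> p \<in> V \<Longrightarrow>
                 P (insert l V) (insert (l, p) (insert (p, l) E))"
  shows "P V E"
  using assms(1)
proof (induction "card V" arbitrary: V E rule: less_induct)
  case less
  have fin: "finite V" and ne: "V \<noteq> {}" and EV: "E \<subseteq> V \<times> V" and irr: "irrefl E"
    using less.prems by (auto simp: rel_tree_def)
  show ?case
  proof (cases "2 \<le> card V")
    case True
    then obtain l p where l: "l \<in> V" and lp: "{w. (l, w) \<in> E} = {p}"
      using rel_tree_has_leaf[OF less.prems] by blast
    note rem = rel_tree_remove_leaf[OF less.prems l lp]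
    have "card (V - {l}) < card V"
      using fin l by (rule card_Diff1_less)
    then have "P (V - {l}) (E \<inter> (V - {l}) \<times> (V - {l}))"
      using less.hyps rem(1) by blast
    then show ?thesis
      using leaf[OF rem(1) _ _ rem(2), of l] rem(3) l by (simp add: insert_absorb)
  next
    case False
    then have "card V = 1"
      using fin ne by (metis One_nat_def Suc_1 card_gt_0_iff le_neq_implies_less less_one
          linorder_not_less not_less_eq_eq)
    then obtain v where V: "V = {v}"
      by (rule card_1_singletonE)
    then have "E = {}"
      using EV irr by (auto simp: irrefl_def)
    then show ?thesis
      using V single by simp
  qed
qed

lemma rel_tree_card_arcs:
  assumes "rel_tree V E"
  shows "card E + 2 = 2 * card V"
  using assms
proof (induction rule: rel_tree_induct)
  case (single v)
  then show ?case by simp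
next
  case (leaf V E l p)
  then have "finite V" and EV: "E \<subseteq> V \<times> V"
    by (auto simp: rel_tree_def)
  then have "finite E"
    by (meson finite_SigmaI finite_subset)
  moreover have "(l, p) \<notin> insert (p, l) E" "(p, l) \<notin> E"
    using leaf EV by auto
  ultimately show ?case
    using leaf \<open>finite V\<close> by simp
qed

lemma rel_tree_two_colouring:
  assumes "rel_tree V E"
  shows "\<exists>X Y. X \<union> Y = V \<and> X \<inter> Y = {} \<and> E \<subseteq> X \<times> Y \<union> Y \<times> X"
  using assms
proof (induction rule: rel_tree_induct)
  case (single v)
  have "{v} \<union> {} = {v} \<and> {v} \<inter> {} = {} \<and> {} \<subseteq> {v} \<times> {} \<union> {} \<times> {v}"
    by simp
  then show ?case
    by (intro exI)
next
  case (leaf V E l p)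
  then obtain X Y where XY: "X \<union> Y = V" "X \<inter> Y = {}" "E \<subseteq> X \<times> Y \<union> Y \<times> X"
    by (elim exE conjE)
  have l: "l \<notin> X" "l \<notin> Y"
    using XY(1) \<open>l \<notin> V\<close> by blast+
  show ?case
  proof (cases "p \<in> X")
    case True
    have "X \<union> insert l Y = insert l V" "X \<inter> insert l Y = {}"
      using XY l by simp_all
    moreover have "insert (l, p) (insert (p, l) E) \<subseteq> X \<times> insert l Y \<union> insert l Y \<times> X"
      using True XY(3) by auto
    ultimately show ?thesis
      by (intro exI conjI)
  next
    case False
    then have "p \<in> Y"
      using XY(1) \<open>p \<in> V\<close> by blast
    have "insert l X \<union> Y = insert l V" "insert l X \<inter> Y = {}"
      using XY l by simp_all
    moreover have "insert (l, p) (insert (p, l) E) \<subseteq> insert l X \<times> Y \<union> Y \<times> insert l X"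
      using \<open>p \<in> Y\<close> XY(3) by auto
    ultimately show ?thesis
      by (intro exI conjI)
  qed
qed

section \<open>Simple trees\<close>

text \<open>
  The arcs of the closed walk through the vertices \<open>xs\<close> pair each vertex with its successor. The
  end vertex \<open>z\<close> stays arbitrary because \<open>hd xs\<close> changes along the induction.
\<close>

lemma walk_of_vertex_list:
  assumes "xs \<noteq> []"
  shows "pcas (hd xs) (zip xs (tl xs @ [z])) z"
    and "pawalk_verts (hd xs) (zip xs (tl xs @ [z])) = xs @ [z]"
    and "successively (\<lambda>x y. (x, y) \<in> E) xs \<Longrightarrow> (last xs, z) \<in> E \<Longrightarrow>
           set (zip xs (tl xs @ [z])) \<subseteq> E"
proof -
  show "pcas (hd xs) (zip xs (tl xs @ [z])) z"
    using assms by (induction xs rule: induct_list012) simp_all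
  show "pawalk_verts (hd xs) (zip xs (tl xs @ [z])) = xs @ [z]"
    using assms by (induction xs rule: induct_list012) simp_all
  show "set (zip xs (tl xs @ [z])) \<subseteq> E"
    if "successively (\<lambda>x y. (x, y) \<in> E) xs" "(last xs, z) \<in> E"
    using assms that by (induction xs rule: induct_list012) simp_all
qed

lemma simple_tree_imp_rel_tree:
  assumes "simple_tree T"
  shows "rel_tree (pverts T) (parcs T)"
proof -
  have graph: "pair_graph T" and conn: "Digraph_Component.connected (with_proj T)"
    and acyc: "\<And>p. pre_digraph.cycle (with_proj T) p \<Longrightarrow> length p < 3"
    using assms by (auto simp: simple_tree_def not_le)
  interpret pair_graph T
    by (fact graph)
  have EV: "parcs T \<subseteq> pverts T \<times> pverts T"
    using in_arcsD1 in_arcsD2 by auto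
  have sym: "sym (parcs T)"
    using pair_sym_arcs by (simp add: symmetric_def)
  have irr: "irrefl (parcs T)"
    using pair_no_loops[of "(x, x)" for x] by (auto simp: irrefl_def)
  have "mk_symmetric (with_proj T) = T"
    using sym by (intro pair_pre_digraph.equality) (auto simp: mk_symmetric_def dest: symD)
  then have ne: "pverts T \<noteq> {}"
    and reach: "\<And>u v. u \<in> pverts T \<Longrightarrow> v \<in> pverts T \<Longrightarrow> u \<rightarrow>\<^sup>*\<^bsub>with_proj T\<^esub> v"
    using conn by (auto simp: connected_def strongly_connected_def)
  have star: "(u, v) \<in> (parcs T)\<^sup>*" if "u \<in> pverts T" "v \<in> pverts T" for u v
    using reach[OF that] unfolding reachable_def
    by (auto intro: rtrancl_on_rtranclI)
  have "\<not> rel_cycle (parcs T) xs" for xs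
  proof
    assume "rel_cycle (parcs T) xs"
    then have len: "3 \<le> length xs" and dist: "distinct xs"
      and succ: "successively (\<lambda>x y. (x, y) \<in> parcs T) xs" and close: "(last xs, hd xs) \<in> parcs T"
      by (simp_all add: rel_cycle_def)
    let ?p = "zip xs (tl xs @ [hd xs])"
    have "xs \<noteq> []"
      using len by auto
    note walk = walk_of_vertex_list[OF this, where z = "hd xs"]
    have "awalk (hd xs) ?p (hd xs)"
      unfolding awalk_def using walk(1) walk(3)[OF succ close] close EV by auto
    moreover have "distinct (tl (pawalk_verts (hd xs) ?p))"
      using walk(2) dist \<open>xs \<noteq> []\<close> by (cases xs) auto
    moreover have "length ?p = length xs"
      using \<open>xs \<noteq> []\<close> by simp
    ultimately have "cycle ?p" "3 \<le> length ?p"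
      using len unfolding cycle_def by auto
    then show False
      using acyc by fastforce
  qed
  then show ?thesis
    unfolding rel_tree_def using pair_finite_verts ne EV sym irr star by blast
qed

lemma bipartition_swap: "bipartition T X Y \<longleftrightarrow> bipartition T Y X"
  unfolding bipartition_def by (simp add: Un_commute Int_commute disj_commute)

text \<open>Reversal of arcs exchanges the arcs that leave the two classes.\<close>

lemma simple_tree_card_arcs_from_class:
  assumes tree: "simple_tree T" and bip: "bipartition T X Y"
  shows "card {(u, v) \<in> parcs T. u \<notin> X} = card (pverts T) - 1"
proof -
  let ?A = "{(u, v) \<in> parcs T. u \<notin> X}" and ?B = "{(u, v) \<in> parcs T. u \<in> X}"
  interpret pair_graph T
    using tree by (simp add: simple_tree_def)
  have cls: "(u \<in> X \<and> v \<notin> X) \<or> (u \<notin> X \<and> v \<in> X)" if "(u, v) \<in> parcs T" for u v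
    using bip that by (auto simp: bipartition_def)
  have "prod.swap ` ?A \<subseteq> ?B" "prod.swap ` ?B \<subseteq> ?A"
    using cls arcs_symmetric by fastforce+
  then have "bij_betw prod.swap ?A ?B"
    by (intro bij_betw_byWitness[where f' = prod.swap]) simp_all
  then have "card ?A = card ?B"
    by (rule bij_betw_same_card)
  moreover have "card (parcs T) = card ?A + card ?B"
  proof -
    have "finite ?A" "finite ?B"
      by (rule finite_subset[OF _ pair_finite_arcs]; blast)+
    moreover have "?A \<inter> ?B = {}" "?A \<union> ?B = parcs T"
      by blast+
    ultimately show ?thesis
      using card_Un_disjoint[of ?A ?B] by simp
  qed
  ultimately show ?thesis
    using rel_tree_card_arcs[OF simple_tree_imp_rel_tree[OF tree]] by simp
qed

section \<open>Factorizations from independent sets\<close>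

lemma even_card_imp_perfect_matching:
  assumes "finite S" "even (card S)"
  shows "\<exists>\<sigma>. \<forall>u\<in>S. \<sigma> u \<in> S \<and> \<sigma> u \<noteq> u \<and> \<sigma> (\<sigma> u) = u"
  using assms
proof (induction "card S" arbitrary: S rule: less_induct)
  case less
  show ?case
  proof (cases "S = {}")
    case False
    then obtain a where a: "a \<in> S" by blast
    then have "S \<noteq> {a}"
      using less.prems by auto
    then obtain b where b: "b \<in> S" "b \<noteq> a"
      using a by blast
    let ?R = "S - {a, b}"
    have "S = insert a (insert b ?R)"
      using a b by blast
    then have "card S = card (insert a (insert b ?R))"
      by (rule arg_cong)
    also have "\<dots> = card ?R + 2"
      using b less.prems(1) by simp
    finally have card: "card S = card ?R + 2" .
    then have "card ?R < card S" "even (card ?R)" "finite ?R"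
      using less.prems by simp_all
    then obtain \<sigma> where \<sigma>: "\<forall>u\<in>?R. \<sigma> u \<in> ?R \<and> \<sigma> u \<noteq> u \<and> \<sigma> (\<sigma> u) = u"
      using less.hyps by blast
    let ?\<tau> = "\<sigma>(a := b, b := a)"
    have "?\<tau> u \<in> S \<and> ?\<tau> u \<noteq> u \<and> ?\<tau> (?\<tau> u) = u" if "u \<in> S" for u
    proof (cases "u = a \<or> u = b")
      case True
      then show ?thesis
        using a b by auto
    next
      case False
      then have "\<sigma> u \<in> ?R" "\<sigma> u \<noteq> u" "\<sigma> (\<sigma> u) = u"
        using \<sigma> that by blast+
      then show ?thesis
        using False by simp
    qed
    then show ?thesis
      by blast
  qed auto
qed

text \<open>
  The factor \<open>H\<close> matches \<open>u\<close> with \<open>\<sigma> u\<close> and \<open>K\<close> joins \<open>\<sigma> u\<close> to the neighbours of \<open>u\<close>. Independence of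
  \<open>S\<close> makes \<open>K\<close> loop-free, and guarantees that every edge of \<open>K\<close> at \<open>\<sigma> u\<close> stems from \<open>u\<close>.
\<close>

lemma factorization_from_independent_set:
  assumes graph: "pair_graph G" and SV: "S \<subseteq> pverts G" and "even (card S)"
    and indep: "\<And>u v. (u, v) \<in> parcs G \<Longrightarrow> u \<in> S \<Longrightarrow> v \<notin> S"
  shows "admits_factorization
           (real (card {(u, v) \<in> parcs G. u \<notin> S}) / (real (card (pverts G)))\<^sup>2) G"
proof -
  interpret pair_graph G
    by (fact graph)
  let ?V = "pverts G" and ?E = "{(u, v) \<in> parcs G. u \<notin> S}"
  have finV: "finite ?V"
    by (rule pair_finite_verts)
  then have "finite S"
    using SV by (rule rev_finite_subset)
  then obtain \<sigma> where \<sigma>: "\<And>u. u \<in> S \<Longrightarrow> \<sigma> u \<in> S" "\<And>u. u \<in> S \<Longrightarrow> \<sigma> u \<noteq> u"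
      "\<And>u. u \<in> S \<Longrightarrow> \<sigma> (\<sigma> u) = u"
    using even_card_imp_perfect_matching[OF _ \<open>even (card S)\<close>] by blast
  define H :: "'a pair_pre_digraph" where "H = \<lparr>pverts = ?V, parcs = {(u, \<sigma> u) | u. u \<in> S}\<rparr>"
  define KS where "KS = {(\<sigma> u, v) | u v. u \<in> S \<and> (u, v) \<in> parcs G}"
  define K :: "'a pair_pre_digraph" where "K = \<lparr>pverts = ?V, parcs = KS \<union> KS\<inverse>\<rparr>"
  have EV: "parcs G \<subseteq> ?V \<times> ?V"
    using in_arcsD1 in_arcsD2 by auto
  have arcsH: "parcs H \<subseteq> ?V \<times> ?V" and arcsK: "parcs K \<subseteq> ?V \<times> ?V"
    using SV \<sigma>(1) EV by (auto simp: H_def K_def KS_def)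
  have finHK: "finite (parcs H)" "finite (parcs K)"
    using arcsH arcsK finV by (meson finite_SigmaI finite_subset)+
  have "sym (parcs H)"
    using \<sigma> by (auto simp: H_def sym_def)
  moreover have "sym (parcs K)"
    by (auto simp: K_def sym_def)
  moreover have "(x, x) \<notin> parcs H" for x
    using \<sigma>(2)[of x] by (auto simp: H_def)
  moreover have "(x, x) \<notin> parcs K" for x
    using \<sigma>(1) indep by (auto simp: K_def KS_def)
  ultimately have graphs: "pair_graph H" "pair_graph K"
    by (unfold_locales;
        use arcsH arcsK finV finHK in \<open>force simp: symmetric_def H_def K_def\<close>)+
  have correct: "card (neighbours H u \<inter> neighbours K v) = (if (u, v) \<in> parcs G then 1 else 0)"
    if "(u, v) \<notin> ?E" for u v
  proof (cases "u \<in> S")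
    case True
    have "(v, \<sigma> u) \<in> parcs K \<longleftrightarrow> (u, v) \<in> parcs G"
    proof
      assume "(v, \<sigma> u) \<in> parcs K"
      then consider "(v, \<sigma> u) \<in> KS" | "(\<sigma> u, v) \<in> KS"
        by (auto simp: K_def)
      then show "(u, v) \<in> parcs G"
      proof cases
        case 1
        then show ?thesis
          using indep \<sigma>(1)[OF True] by (auto simp: KS_def)
      next
        case 2
        then show ?thesis
          using \<sigma>(3) True by (auto simp: KS_def) metis
      qed
    next
      assume "(u, v) \<in> parcs G"
      then show "(v, \<sigma> u) \<in> parcs K"
        using True by (auto simp: K_def KS_def)
    qed
    moreover have "neighbours H u = {\<sigma> u}"
      using True by (auto simp: neighbours_def H_def)
    ultimately show ?thesis
      by (auto simp: neighbours_def)
  next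
    case False
    then have "neighbours H u = {}"
      by (auto simp: neighbours_def H_def)
    then show ?thesis
      using False that by simp
  qed
  have EVV: "?E \<subseteq> ?V \<times> ?V"
    using EV by auto
  then have "card ?E \<le> card (?V \<times> ?V)"
    using finV by (intro card_mono) auto
  then have bound: "real (card ?E) \<le> (real (card ?V))\<^sup>2"
    by (simp add: card_cartesian_product power2_eq_square flip: of_nat_mult)
  let ?\<epsilon> = "real (card ?E) / (real (card ?V))\<^sup>2"
  have "0 \<le> ?\<epsilon>" "?\<epsilon> \<le> 1" "real (card ?E) \<le> ?\<epsilon> * (real (card ?V))\<^sup>2"
    using bound by (auto simp: divide_le_eq_1)
  then show ?thesis
    unfolding admits_factorization_def
    using graphs EVV correct
    by (intro conjI exI[of _ H] exI[of _ K] exI[of _ ?E]) (auto simp: H_def K_def)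
qed

section \<open>Factorizations of trees\<close>

lemma tree_factorization_even_class:
  assumes tree: "simple_tree T" and "card (pverts T) = n" and "2 \<le> n"
    and bip: "bipartition T X Y" and "even (card X)"
  shows "admits_factorization ((real n - 1) / (real n)\<^sup>2) T"
proof -
  have "pair_graph T"
    using tree by (simp add: simple_tree_def)
  moreover have "X \<subseteq> pverts T" "\<And>u v. (u, v) \<in> parcs T \<Longrightarrow> u \<in> X \<Longrightarrow> v \<notin> X"
    using bip unfolding bipartition_def by blast+
  ultimately have "admits_factorization
      (real (card {(u, v) \<in> parcs T. u \<notin> X}) / (real (card (pverts T)))\<^sup>2) T"
    using \<open>even (card X)\<close> by (intro factorization_from_independent_set)
  then show ?thesis
    using simple_tree_card_arcs_from_class[OF tree bip] assms(2,3) by (simp add: of_nat_diff)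
qed

text \<open>
  Without the leaf the class has even size, and the row of the leaf, which becomes zero in the
  product, contains a single one.
\<close>

lemma tree_factorization_odd_class_with_leaf:
  assumes tree: "simple_tree T" and "card (pverts T) = n" and "2 \<le> n"
    and bip: "bipartition T X Y" and "odd (card X)"
    and "l \<in> X" and leaf: "{w. (l, w) \<in> parcs T} = {p}"
  shows "admits_factorization (real n / (real n)\<^sup>2) T"
proof -
  interpret pair_graph T
    using tree by (simp add: simple_tree_def)
  have X: "X \<subseteq> pverts T" "\<And>u v. (u, v) \<in> parcs T \<Longrightarrow> u \<in> X \<Longrightarrow> v \<notin> X"
    using bip unfolding bipartition_def by blast+
  have "finite X"
    using X(1) pair_finite_verts by (rule finite_subset)
  then have "even (card (X - {l}))"
    using \<open>odd (card X)\<close> \<open>l \<in> X\<close> by (simp add: card_Diff_singleton)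
  then have "admits_factorization
      (real (card {(u, v) \<in> parcs T. u \<notin> X - {l}}) / (real (card (pverts T)))\<^sup>2) T"
    using X by (intro factorization_from_independent_set) (auto intro: pair_graph_axioms)
  moreover have "{(u, v) \<in> parcs T. u \<notin> X - {l}} = insert (l, p) {(u, v) \<in> parcs T. u \<notin> X}"
    using leaf by auto
  moreover have "card (insert (l, p) {(u, v) \<in> parcs T. u \<notin> X}) = n"
  proof -
    have "finite {(u, v) \<in> parcs T. u \<notin> X}"
      by (rule finite_subset[OF _ pair_finite_arcs]) blast
    then show ?thesis
      using simple_tree_card_arcs_from_class[OF tree bip] assms(2,3) \<open>l \<in> X\<close> by simp
  qed
  ultimately show ?thesis
    using assms(2) by simp
qed

lemma tree_factorization_odd_classes:
  assumes tree: "simple_tree T" and n: "card (pverts T) = n" "2 \<le> n"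
    and bip: "bipartition T X Y" and odd: "odd (card X)" "odd (card Y)"
  shows "admits_factorization (real n / (real n)\<^sup>2) T"
proof -
  obtain l p where l: "l \<in> pverts T" and leaf: "{w. (l, w) \<in> parcs T} = {p}"
    using rel_tree_has_leaf[OF simple_tree_imp_rel_tree[OF tree]] n by blast
  then consider "l \<in> X" | "l \<in> Y"
    using bip unfolding bipartition_def by blast
  then show ?thesis
  proof cases
    case 1
    then show ?thesis
      using tree_factorization_odd_class_with_leaf[OF tree n bip odd(1) _ leaf] by simp
  next
    case 2
    have "bipartition T Y X"
      using bip bipartition_swap by blast
    then show ?thesis
      using tree_factorization_odd_class_with_leaf[OF tree n _ odd(2) 2 leaf] by simp
  qed
qed

theorem theorem5:
  fixes T :: "'a pair_pre_digraph" and n :: nat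
  assumes "simple_tree T" and "card (pverts T) = n" and "n \<ge> 2"
  shows "(\<exists>\<epsilon>. \<epsilon> \<le> 1 / real n \<and> admits_factorization \<epsilon> T) \<and>
    (\<forall>X Y. bipartition T X Y \<longrightarrow>
       (even (card X) \<or> even (card Y) \<longrightarrow>
          (\<exists>\<epsilon>. \<epsilon> \<le> (real n - 1) / (real n)\<^sup>2 \<and> admits_factorization \<epsilon> T)) \<and>
       (odd (card X) \<and> odd (card Y) \<longrightarrow>
          (\<exists>\<epsilon>. \<epsilon> \<le> real n / (real n)\<^sup>2 \<and> admits_factorization \<epsilon> T)))"
proof -
  have even: "admits_factorization ((real n - 1) / (real n)\<^sup>2) T"
    if "bipartition T X Y" "even (card X) \<or> even (card Y)" for X Y
    using that tree_factorization_even_class[OF assms] bipartition_swap by blast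
  have odd: "admits_factorization (real n / (real n)\<^sup>2) T"
    if "bipartition T X Y" "odd (card X)" "odd (card Y)" for X Y
    using that tree_factorization_odd_classes[OF assms] by blast
  obtain X Y where "X \<union> Y = pverts T" "X \<inter> Y = {}" "parcs T \<subseteq> X \<times> Y \<union> Y \<times> X"
    using rel_tree_two_colouring[OF simple_tree_imp_rel_tree[OF assms(1)]] by blast
  then have XY: "bipartition T X Y"
    by (auto simp: bipartition_def)
  have "(real n - 1) / (real n)\<^sup>2 \<le> 1 / real n" "real n / (real n)\<^sup>2 \<le> 1 / real n"
    using \<open>n \<ge> 2\<close> by (auto simp: power2_eq_square field_simps)
  then have "\<exists>\<epsilon>. \<epsilon> \<le> 1 / real n \<and> admits_factorization \<epsilon> T"
    using even[OF XY] odd[OF XY] by blast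
  then show ?thesis
    using even odd by blast
qed

end
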